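(* Let $G$ be a group and $A$ a left $G$-set. Let $P'A$ be the set of proper subsets of $A$, on which $G$ acts by $B\mapsto gB=\{gb\mid b\in B\}$, and let $S\subseteq P'A$ be a choice of one representative for each orbit of this action. Then there is an isomorphism of functors of $X$ $$\Delta[X^A/G]\cong\sum_{B\in S}X^B/\mathrm{Stab}(B),$$ where $\mathrm{Stab}(B)=\{g\in G\mid gB=B\}$ is the stabilizer of $B$.
   Context: For a group $G$ and a left $G$-set $A$, $G$ acts on the right on $X^A$ (functions $A\to X$) by precomposition, $(f\cdot g)(a)=f(ga)$, and $X^A/G$ is the set of orbits; $X\mapsto X^A/G$ is a functor $\mathbf{Set}\to\mathbf{Set}$ which is taut, i.e. preserves pullback squares in which one leg is a monomorphism. $\mathrm{Stab}(B)$ acts on $B$ by restriction, and $X^B/\mathrm{Stab}(B)$ is defined in the same way. For a taut functor $F \colon \mathbf{Set}\to\mathbf{Set}$, with $j_X \colon X\to X+1$ the coproduct injection, the difference functor is $\Delta[F](X)=F(X+1)\setminus\mathrm{Im}\,F(j_X)$, and for $f \colon X\to Y$, $\Delta[F](f)$ is the restriction of $F(f+1)$ (which does restrict, because $F$ is taut). $\sum$ denotes coproduct of functors. *)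

theory Defs
  imports "HOL-Algebra.Group_Action"
begin

text \<open>
  The category of sets is rendered as the full category of subsets of a type \<open>'u\<close>, a morphism
  \<open>X \<rightarrow> Y\<close> being an element of \<open>X \<rightarrow>\<^sub>E Y\<close>, so that equality of morphisms is HOL equality.
  The type \<open>'u\<close> is a parameter, and the values of a functor may lie in a different type \<open>'v\<close>.
\<close>

record ('u, 'v) set_functor =
  Ob :: "'u set \<Rightarrow> 'v set"
  Ar :: "'u set \<Rightarrow> 'u set \<Rightarrow> ('u \<Rightarrow> 'u) \<Rightarrow> ('v \<Rightarrow> 'v)"

definition is_functor :: "('u, 'v) set_functor \<Rightarrow> bool" where
  "is_functor F \<longleftrightarrow>
     (\<forall>X Y. \<forall>f \<in> X \<rightarrow>\<^sub>E Y. Ar F X Y f \<in> Ob F X \<rightarrow>\<^sub>E Ob F Y) \<and>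
     (\<forall>X. Ar F X X (\<lambda>x\<in>X. x) = (\<lambda>u\<in>Ob F X. u)) \<and>
     (\<forall>X Y Z. \<forall>f \<in> X \<rightarrow>\<^sub>E Y. \<forall>g \<in> Y \<rightarrow>\<^sub>E Z.
        Ar F X Z (compose X g f) = compose (Ob F X) (Ar F Y Z g) (Ar F X Y f))"

definition is_natural_iso ::
    "('u, 'v) set_functor \<Rightarrow> ('u, 'w) set_functor \<Rightarrow> ('u set \<Rightarrow> 'v \<Rightarrow> 'w) \<Rightarrow> bool" where
  "is_natural_iso F H \<eta> \<longleftrightarrow>
     (\<forall>X. bij_betw (\<eta> X) (Ob F X) (Ob H X)) \<and>
     (\<forall>X Y. \<forall>f \<in> X \<rightarrow>\<^sub>E Y. \<forall>u \<in> Ob F X. \<eta> Y (Ar F X Y f u) = Ar H X Y f (\<eta> X u))"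

definition isomorphic_functors ::
    "('u, 'v) set_functor \<Rightarrow> ('u, 'w) set_functor \<Rightarrow> bool" where
  "isomorphic_functors F H \<longleftrightarrow>
     is_functor F \<and> is_functor H \<and> (\<exists>\<eta>. is_natural_iso F H \<eta>)"

definition sum_functor ::
    "'i set \<Rightarrow> ('i \<Rightarrow> ('u, 'v) set_functor) \<Rightarrow> ('u, 'i \<times> 'v) set_functor" where
  "sum_functor I F =
     \<lparr> Ob = (\<lambda>X. SIGMA i:I. Ob (F i) X),
       Ar = (\<lambda>X Y f. \<lambda>(i, u) \<in> (SIGMA i:I. Ob (F i) X). (i, Ar (F i) X Y f u)) \<rparr>"

text \<open>
  The coproduct \<open>X + 1\<close> inside \<open>'u\<close>: the injection \<open>j\<^sub>X\<close> is the restriction to \<open>X\<close> of a map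
  \<open>inl\<close>, and \<open>pt\<close> is the added point. This is a coproduct when \<open>inl\<close> is injective and \<open>pt\<close>
  is not in its range; such \<open>inl\<close> and \<open>pt\<close> exist exactly when \<open>'u\<close> is infinite.
\<close>

definition plus1 :: "('u \<Rightarrow> 'u) \<Rightarrow> 'u \<Rightarrow> 'u set \<Rightarrow> 'u set" where
  "plus1 inl pt X = insert pt (inl ` X)"

definition plus1_map :: "('u \<Rightarrow> 'u) \<Rightarrow> 'u \<Rightarrow> 'u set \<Rightarrow> ('u \<Rightarrow> 'u) \<Rightarrow> ('u \<Rightarrow> 'u)" where
  "plus1_map inl pt X f =
     (\<lambda>z \<in> plus1 inl pt X. if z = pt then pt else inl (f (inv_into X inl z)))"

text \<open>
  The definition makes sense for every functor \<open>F\<close>; tautness of \<open>F\<close> ensures that the result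
  satisfies \<^const>\<open>is_functor\<close>.
\<close>

definition difference_functor ::
    "('u \<Rightarrow> 'u) \<Rightarrow> 'u \<Rightarrow> ('u, 'v) set_functor \<Rightarrow> ('u, 'v) set_functor" where
  "difference_functor inl pt F =
     (let D = (\<lambda>X. Ob F (plus1 inl pt X) - Ar F X (plus1 inl pt X) (\<lambda>x\<in>X. inl x) ` Ob F X)
      in \<lparr> Ob = D,
           Ar = (\<lambda>X Y f. restrict
                  (Ar F (plus1 inl pt X) (plus1 inl pt Y) (plus1_map inl pt X f)) (D X)) \<rparr>)"

text \<open>
  For a left action \<open>\<phi>\<close> of \<open>G\<close> on \<open>A\<close>, the orbit of \<open>f\<close> under the right action
  \<open>f \<cdot> g = f \<circ> \<phi> g\<close>. In the functor \<open>X \<mapsto> X\<^sup>A/G\<close> below, the image of the orbit of \<open>f\<close> under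
  post-composition with \<open>h\<close> is the orbit of \<open>h \<circ> f\<close>.
\<close>

definition right_orbit ::
    "('g, 'm) monoid_scheme \<Rightarrow> 'a set \<Rightarrow> ('g \<Rightarrow> 'a \<Rightarrow> 'a) \<Rightarrow> ('a \<Rightarrow> 'u) \<Rightarrow> ('a \<Rightarrow> 'u) set" where
  "right_orbit G A \<phi> f = {compose A f (\<phi> g) | g. g \<in> carrier G}"

definition power_quotient ::
    "('g, 'm) monoid_scheme \<Rightarrow> 'a set \<Rightarrow> ('g \<Rightarrow> 'a \<Rightarrow> 'a) \<Rightarrow> ('u, ('a \<Rightarrow> 'u) set) set_functor" where
  "power_quotient G A \<phi> =
     (let Q = (\<lambda>X. {right_orbit G A \<phi> f | f. f \<in> A \<rightarrow>\<^sub>E X})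
      in \<lparr> Ob = Q, Ar = (\<lambda>X Y h. \<lambda>u \<in> Q X. compose A h ` u) \<rparr>)"

definition proper_subsets :: "'a set \<Rightarrow> 'a set set" where
  "proper_subsets A = {B. B \<subset> A}"

definition subset_action :: "'a set \<Rightarrow> ('g \<Rightarrow> 'a \<Rightarrow> 'a) \<Rightarrow> 'g \<Rightarrow> 'a set \<Rightarrow> 'a set" where
  "subset_action A \<phi> g = (\<lambda>B \<in> proper_subsets A. \<phi> g ` B)"

definition orbit_representatives ::
    "('g, 'm) monoid_scheme \<Rightarrow> 'e set \<Rightarrow> ('g \<Rightarrow> 'e \<Rightarrow> 'e) \<Rightarrow> 'e set \<Rightarrow> bool" where
  "orbit_representatives G E \<psi> S \<longleftrightarrow>
     S \<subseteq> E \<and> (\<forall>O' \<in> orbits G E \<psi>. \<exists>!x. x \<in> S \<and> x \<in> O')"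

abbreviation set_stabilizer ::
    "('g, 'm) monoid_scheme \<Rightarrow> 'a set \<Rightarrow> ('g \<Rightarrow> 'a \<Rightarrow> 'a) \<Rightarrow> 'a set \<Rightarrow> 'g set" where
  "set_stabilizer G A \<phi> B \<equiv> stabilizer G (subset_action A \<phi>) B"

end

(*
  A map f : A -> X + 1 is the same thing as a subset B of A (the preimage of X) together with a
  map B -> X, and it factors through X iff B = A. Acting by g on f replaces B by its translate
  under the inverse of g. Hence every orbit outside the image of X^A/G contains maps whose
  subset B lies in S, this B is unique, and the maps in the orbit with this B form a single
  Stab(B)-orbit in X^B. Post-composition with k + 1 leaves B unchanged, which gives naturality.
*)
theory Submission
  imports Defs
begin

section \<open>The functor X^A/G\<close>

text \<open>Post-composition with \<open>h\<close> commutes with precomposition by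
  \<open>\<phi> g\<close>, so it carries orbits onto orbits. Since \<open>compose A\<close> is
  truncated outside \<open>A\<close>, each \<open>\<phi> g\<close> has to map \<open>A\<close> into
  itself.\<close>

lemma Ar_power_quotient_orbit:
  assumes "\<And>g. g \<in> carrier G \<Longrightarrow> \<phi> g \<in> A \<rightarrow> A" and "f \<in> A \<rightarrow>\<^sub>E X"
  shows "Ar (power_quotient G A \<phi>) X Y h (right_orbit G A \<phi> f) = right_orbit G A \<phi> (compose A h f)"
proof -
  have "compose A h (compose A f (\<phi> g)) = compose A (compose A h f) (\<phi> g)" if "g \<in> carrier G" for g
    using assms(1)[OF that] by (auto simp: compose_def fun_eq_iff Pi_iff)
  then have "compose A h ` right_orbit G A \<phi> f = right_orbit G A \<phi> (compose A h f)"
    unfolding right_orbit_def by (force simp: image_iff)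
  then show ?thesis
    using assms(2) by (auto simp: power_quotient_def Let_def)
qed

lemma Ob_power_quotient: "Ob (power_quotient G A \<phi>) X = right_orbit G A \<phi> ` (A \<rightarrow>\<^sub>E X)"
  by (auto simp: power_quotient_def Let_def)

lemma PiE_compose: "f \<in> A \<rightarrow>\<^sub>E X \<Longrightarrow> h \<in> X \<rightarrow>\<^sub>E Y \<Longrightarrow> compose A h f \<in> A \<rightarrow>\<^sub>E Y"
  by (auto simp: compose_def Pi_iff PiE_iff)

text \<open>Stated for a family of self-maps of \<open>A\<close>, so that it covers both the action
  of \<open>G\<close> and the restricted actions of the stabilizers.\<close>

lemma is_functor_power_quotient:
  assumes "\<And>g. g \<in> carrier G \<Longrightarrow> \<phi> g \<in> A \<rightarrow> A"
  shows "is_functor (power_quotient G A \<phi> :: ('u, ('a \<Rightarrow> 'u) set) set_functor)"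
proof -
  let ?F = "power_quotient G A \<phi> :: ('u, ('a \<Rightarrow> 'u) set) set_functor"
  note Ar_orbit = Ar_power_quotient_orbit[of G \<phi> A, OF assms]
  \<comment> \<open>Arrows are extensional, so each functor law only has to be compared on orbits of
    maps.\<close>
  have ext: "Ar ?F X Y h \<in> extensional (Ob ?F X)" for X Y h
    by (simp add: power_quotient_def Let_def)
  have maps: "Ar ?F X Y h \<in> Ob ?F X \<rightarrow>\<^sub>E Ob ?F Y" if "h \<in> X \<rightarrow>\<^sub>E Y" for X Y h
  proof (rule PiE_I)
    show "Ar ?F X Y h u \<in> Ob ?F Y" if "u \<in> Ob ?F X" for u
      using that
      by (auto simp: Ob_power_quotient Ar_orbit intro!: imageI PiE_compose[OF _ \<open>h \<in> X \<rightarrow>\<^sub>E Y\<close>])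
  qed (use ext in \<open>simp add: extensional_def\<close>)
  have ident: "Ar ?F X X (\<lambda>x\<in>X. x) = (\<lambda>u\<in>Ob ?F X. u)" for X
  proof (rule extensionalityI[OF ext])
    show "Ar ?F X X (\<lambda>x\<in>X. x) u = (\<lambda>u\<in>Ob ?F X. u) u" if u: "u \<in> Ob ?F X" for u
    proof -
      obtain f where f: "f \<in> A \<rightarrow>\<^sub>E X" "u = right_orbit G A \<phi> f"
        using u by (auto simp: Ob_power_quotient)
      have "compose A (\<lambda>x\<in>X. x) f = f"
        using f(1) by (auto simp: compose_def fun_eq_iff PiE_iff Pi_iff extensional_def)
      then show ?thesis using u f by (simp add: Ar_orbit)
    qed
  qed simp
  have comp: "Ar ?F X Z (compose X g f) = compose (Ob ?F X) (Ar ?F Y Z g) (Ar ?F X Y f)"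
    if fg: "f \<in> X \<rightarrow>\<^sub>E Y" "g \<in> Y \<rightarrow>\<^sub>E Z" for X Y Z f g
  proof (rule extensionalityI[OF ext])
    show "Ar ?F X Z (compose X g f) u = compose (Ob ?F X) (Ar ?F Y Z g) (Ar ?F X Y f) u"
      if u: "u \<in> Ob ?F X" for u
    proof -
      obtain k where k: "k \<in> A \<rightarrow>\<^sub>E X" "u = right_orbit G A \<phi> k"
        using u by (auto simp: Ob_power_quotient)
      have "compose A f k \<in> A \<rightarrow>\<^sub>E Y"
        using k(1) fg(1) by (rule PiE_compose)
      moreover have "compose A (compose X g f) k = compose A g (compose A f k)"
        using k(1) by (auto simp: compose_def fun_eq_iff PiE_iff)
      ultimately show ?thesis using u k by (simp add: Ar_orbit compose_eq)
    qed
  qed simp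
  show ?thesis
    unfolding is_functor_def by (intro conjI allI ballI maps ident comp)
qed

section \<open>Coproducts of functors\<close>

lemma is_functor_sum:
  fixes F :: "'i \<Rightarrow> ('u, 'v) set_functor"
  assumes "\<And>i. i \<in> I \<Longrightarrow> is_functor (F i)"
  shows "is_functor (sum_functor I F)"
  unfolding is_functor_def
proof (intro conjI allI ballI)
  fix X Y :: "'u set" and f assume "f \<in> X \<rightarrow>\<^sub>E Y"
  then have "Ar (F i) X Y f \<in> Ob (F i) X \<rightarrow>\<^sub>E Ob (F i) Y" if "i \<in> I" for i
    using assms[OF that] by (auto simp: is_functor_def)
  then show "Ar (sum_functor I F) X Y f \<in> Ob (sum_functor I F) X \<rightarrow>\<^sub>E Ob (sum_functor I F) Y"
    by (fastforce simp: sum_functor_def PiE_iff)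
next
  fix X :: "'u set"
  have "Ar (F i) X X (\<lambda>x\<in>X. x) = (\<lambda>u\<in>Ob (F i) X. u)" if "i \<in> I" for i
    using assms[OF that] by (auto simp: is_functor_def)
  then show "Ar (sum_functor I F) X X (\<lambda>x\<in>X. x) = (\<lambda>u\<in>Ob (sum_functor I F) X. u)"
    by (auto simp: sum_functor_def fun_eq_iff restrict_def)
next
  fix X Y Z :: "'u set" and f g assume fg: "f \<in> X \<rightarrow>\<^sub>E Y" "g \<in> Y \<rightarrow>\<^sub>E Z"
  have "Ar (F i) X Z (compose X g f) = compose (Ob (F i) X) (Ar (F i) Y Z g) (Ar (F i) X Y f)"
    and "Ar (F i) X Y f \<in> Ob (F i) X \<rightarrow>\<^sub>E Ob (F i) Y" if "i \<in> I" for i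
    using assms[OF that] fg by (auto simp: is_functor_def)
  then show "Ar (sum_functor I F) X Z (compose X g f) =
      compose (Ob (sum_functor I F) X) (Ar (sum_functor I F) Y Z g) (Ar (sum_functor I F) X Y f)"
    by (fastforce simp: sum_functor_def fun_eq_iff restrict_def compose_def PiE_iff)
qed

section \<open>The functor X + 1\<close>

lemma inv_into_inj: "inj inl \<Longrightarrow> x \<in> X \<Longrightarrow> inv_into X inl (inl x) = x"
  by (meson inj_on_subset inv_into_f_f subset_UNIV)

lemma plus1_map_pt [simp]: "plus1_map inl pt X f pt = pt"
  by (simp add: plus1_map_def plus1_def)

lemma plus1_map_inl [simp]:
  "inj inl \<Longrightarrow> pt \<notin> range inl \<Longrightarrow> x \<in> X \<Longrightarrow> plus1_map inl pt X f (inl x) = inl (f x)"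
  by (auto simp: plus1_map_def plus1_def inv_into_inj)

lemma plus1_map_in_PiE:
  "inj inl \<Longrightarrow> pt \<notin> range inl \<Longrightarrow> f \<in> X \<rightarrow>\<^sub>E Y \<Longrightarrow>
    plus1_map inl pt X f \<in> plus1 inl pt X \<rightarrow>\<^sub>E plus1 inl pt Y"
  by (auto simp: plus1_map_def plus1_def inv_into_inj PiE_iff)

lemma plus1_map_id:
  "inj inl \<Longrightarrow> pt \<notin> range inl \<Longrightarrow> plus1_map inl pt X (\<lambda>x\<in>X. x) = (\<lambda>z\<in>plus1 inl pt X. z)"
  by (auto simp: plus1_map_def plus1_def inv_into_inj fun_eq_iff)

lemma plus1_map_compose:
  "inj inl \<Longrightarrow> pt \<notin> range inl \<Longrightarrow> f \<in> X \<rightarrow>\<^sub>E Y \<Longrightarrow>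
    plus1_map inl pt X (compose X g f) =
      compose (plus1 inl pt X) (plus1_map inl pt Y g) (plus1_map inl pt X f)"
  by (auto simp: plus1_map_def plus1_def inv_into_inj fun_eq_iff compose_def PiE_iff)

section \<open>Functoriality of the difference functor\<close>

lemma Ob_difference_functor:
  "Ob (difference_functor inl pt F) X =
    Ob F (plus1 inl pt X) - Ar F X (plus1 inl pt X) (\<lambda>x\<in>X. inl x) ` Ob F X"
  by (simp add: difference_functor_def Let_def)

lemma Ar_difference_functor:
  "Ar (difference_functor inl pt F) X Y f =
    restrict (Ar F (plus1 inl pt X) (plus1 inl pt Y) (plus1_map inl pt X f))
      (Ob (difference_functor inl pt F) X)"
  by (simp add: difference_functor_def Let_def)

text \<open>The last assumption is the only instance of tautness that is needed: the naturality
  square of \<open>j\<close> at \<open>f\<close> is a pullback, and \<open>F\<close> sends it to a pullback.\<close>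

lemma is_functor_difference:
  assumes inl: "inj inl" "pt \<notin> range inl" and F: "is_functor F"
    and taut: "\<And>X Y f u. f \<in> X \<rightarrow>\<^sub>E Y \<Longrightarrow> u \<in> Ob F (plus1 inl pt X) \<Longrightarrow>
      Ar F (plus1 inl pt X) (plus1 inl pt Y) (plus1_map inl pt X f) u
        \<in> Ar F Y (plus1 inl pt Y) (\<lambda>y\<in>Y. inl y) ` Ob F Y \<Longrightarrow>
      u \<in> Ar F X (plus1 inl pt X) (\<lambda>x\<in>X. inl x) ` Ob F X"
  shows "is_functor (difference_functor inl pt F)"
proof -
  let ?D = "difference_functor inl pt F"
  note plus1_PiE = plus1_map_in_PiE[OF inl]
  have F_maps: "Ar F (plus1 inl pt X) (plus1 inl pt Y) (plus1_map inl pt X f)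
      \<in> Ob F (plus1 inl pt X) \<rightarrow>\<^sub>E Ob F (plus1 inl pt Y)" if "f \<in> X \<rightarrow>\<^sub>E Y" for X Y f
    using F plus1_PiE[OF that] by (auto simp: is_functor_def)
  \<comment> \<open>\<open>taut\<close> is used contrapositively: what lies outside the image of
    \<open>F\<close> at \<open>j\<close> stays outside it under \<open>f + 1\<close>.\<close>
  have D_maps: "Ar ?D X Y f \<in> Ob ?D X \<rightarrow>\<^sub>E Ob ?D Y" if f: "f \<in> X \<rightarrow>\<^sub>E Y" for X Y f
    using F_maps[OF f] taut[OF f] by (auto simp: Ar_difference_functor Ob_difference_functor)
  have ident: "Ar ?D X X (\<lambda>x\<in>X. x) = (\<lambda>u\<in>Ob ?D X. u)" for X
    using F by (auto simp: Ar_difference_functor plus1_map_id[OF inl] is_functor_def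
        Ob_difference_functor fun_eq_iff)
  have comp: "Ar ?D X Z (compose X g f) = compose (Ob ?D X) (Ar ?D Y Z g) (Ar ?D X Y f)"
    if fg: "f \<in> X \<rightarrow>\<^sub>E Y" "g \<in> Y \<rightarrow>\<^sub>E Z" for X Y Z f g
  proof (rule extensionalityI)
    fix u assume u: "u \<in> Ob ?D X"
    have "Ar ?D X Y f u \<in> Ob ?D Y"
      using D_maps[OF fg(1)] u by (rule PiE_mem)
    moreover have "Ar F (plus1 inl pt X) (plus1 inl pt Z) (plus1_map inl pt X (compose X g f)) =
        compose (Ob F (plus1 inl pt X))
          (Ar F (plus1 inl pt Y) (plus1 inl pt Z) (plus1_map inl pt Y g))
          (Ar F (plus1 inl pt X) (plus1 inl pt Y) (plus1_map inl pt X f))"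
      unfolding plus1_map_compose[OF inl fg(1)]
      using F plus1_PiE[OF fg(1)] plus1_PiE[OF fg(2)] unfolding is_functor_def by blast
    moreover have "u \<in> Ob F (plus1 inl pt X)"
      using u by (simp add: Ob_difference_functor)
    ultimately show "Ar ?D X Z (compose X g f) u = compose (Ob ?D X) (Ar ?D Y Z g) (Ar ?D X Y f) u"
      using u by (simp add: Ar_difference_functor compose_eq)
  qed (simp_all add: Ar_difference_functor)
  show ?thesis
    unfolding is_functor_def by (intro conjI allI ballI D_maps ident comp)
qed

section \<open>Maps into X + 1 as partial maps into X\<close>

text \<open>The domain of definition of the partial map that \<open>f\<close> encodes, with
  \<open>pt\<close> read as "undefined".\<close>

definition support :: "'u \<Rightarrow> 'a set \<Rightarrow> ('a \<Rightarrow> 'u) \<Rightarrow> 'a set" where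
  "support pt A f = {a \<in> A. f a \<noteq> pt}"

text \<open>The partial map itself, on its domain. The inverse of \<open>inl\<close> is taken on the
  whole type, so that the definition does not mention \<open>X\<close>.\<close>

definition support_part :: "('u \<Rightarrow> 'u) \<Rightarrow> 'u \<Rightarrow> 'a set \<Rightarrow> ('a \<Rightarrow> 'u) \<Rightarrow> ('a \<Rightarrow> 'u)" where
  "support_part inl pt A f = (\<lambda>a\<in>support pt A f. inv_into UNIV inl (f a))"

lemma inl_inv_on_support:
  assumes "f \<in> A \<rightarrow>\<^sub>E plus1 inl pt X" "a \<in> support pt A f"
  shows "inl (inv_into UNIV inl (f a)) = f a"
proof -
  have "f a \<in> plus1 inl pt X" "f a \<noteq> pt"
    using assms by (auto simp: support_def)
  then show ?thesis
    by (auto simp: plus1_def f_inv_into_f)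
qed

lemma support_part_in_PiE:
  assumes "inj inl" "f \<in> A \<rightarrow>\<^sub>E plus1 inl pt X"
  shows "support_part inl pt A f \<in> support pt A f \<rightarrow>\<^sub>E X"
proof (rule PiE_I)
  fix a assume "a \<in> support pt A f"
  then have "f a \<in> plus1 inl pt X" "f a \<noteq> pt" "support_part inl pt A f a = inv_into UNIV inl (f a)"
    using assms(2) by (auto simp: support_def support_part_def)
  then show "support_part inl pt A f a \<in> X"
    using assms(1) by (auto simp: plus1_def)
qed (simp add: support_part_def)

text \<open>Off the support both maps are \<open>pt\<close>, and on it each is recovered from its
  partial map by applying \<open>inl\<close>.\<close>

lemma support_part_inject:
  assumes f: "f \<in> A \<rightarrow>\<^sub>E plus1 inl pt X" and f': "f' \<in> A \<rightarrow>\<^sub>E plus1 inl pt X"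
    and supp: "support pt A f = support pt A f'"
    and part: "support_part inl pt A f = support_part inl pt A f'"
  shows "f = f'"
proof (rule PiE_ext[OF f f'])
  fix a assume a: "a \<in> A"
  show "f a = f' a"
  proof (cases "a \<in> support pt A f")
    case True
    then have "inv_into UNIV inl (f a) = inv_into UNIV inl (f' a)"
      using fun_cong[OF part, of a] supp by (simp add: support_part_def)
    then show ?thesis
      using inl_inv_on_support[OF f] inl_inv_on_support[OF f'] True supp by metis
  next
    case False
    then have "a \<notin> support pt A f'" using supp by simp
    then show ?thesis using False a by (simp add: support_def)
  qed
qed

text \<open>Every partial map occurs: apply \<open>inl\<close> on \<open>B\<close> and send the rest
  of \<open>A\<close> to \<open>pt\<close>.\<close>

lemma support_part_extend:
  assumes "inj inl" "pt \<notin> range inl" "B \<subseteq> A" "h \<in> B \<rightarrow>\<^sub>E X"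
  obtains f where "f \<in> A \<rightarrow>\<^sub>E plus1 inl pt X" "support pt A f = B" "support_part inl pt A f = h"
proof
  let ?f = "\<lambda>a\<in>A. if a \<in> B then inl (h a) else pt"
  show "?f \<in> A \<rightarrow>\<^sub>E plus1 inl pt X"
    using PiE_mem[OF assms(4)] by (auto simp: plus1_def)
  show supp: "support pt A ?f = B"
    using assms(2,3) by (auto simp: support_def)
  show "support_part inl pt A ?f = h"
    unfolding support_part_def supp using assms by (auto simp: fun_eq_iff extensional_def PiE_iff)
qed

text \<open>\<open>k + 1\<close> fixes \<open>pt\<close> and sends every other point of X + 1 into
  the range of \<open>inl\<close>, so no value becomes or ceases to be \<open>pt\<close>.\<close>

lemma support_plus1_map:
  assumes "inj inl" "pt \<notin> range inl" and f: "f \<in> A \<rightarrow>\<^sub>E plus1 inl pt X"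
  shows "support pt A (compose A (plus1_map inl pt X k) f) = support pt A f"
proof -
  have "plus1_map inl pt X k (f a) = pt \<longleftrightarrow> f a = pt" if "a \<in> A" for a
    using PiE_mem[OF f that] assms(1,2) by (auto simp: plus1_def)
  then show ?thesis by (auto simp: support_def compose_def)
qed

text \<open>Naturality before passing to orbits: once \<open>inl\<close> is stripped off,
  \<open>k + 1\<close> acts on the support as \<open>k\<close>.\<close>

lemma support_part_plus1_map:
  assumes "inj inl" "pt \<notin> range inl" and f: "f \<in> A \<rightarrow>\<^sub>E plus1 inl pt X"
  shows "support_part inl pt A (compose A (plus1_map inl pt X k) f) =
    compose (support pt A f) k (support_part inl pt A f)"
proof -
  have "inv_into UNIV inl (plus1_map inl pt X k (f a)) = k (inv_into UNIV inl (f a))"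
    if "a \<in> support pt A f" for a
  proof -
    have "f a \<in> plus1 inl pt X" "f a \<noteq> pt"
      using f that by (auto simp: support_def)
    then show ?thesis using assms(1,2) by (auto simp: plus1_def)
  qed
  then show ?thesis
    unfolding support_part_def support_plus1_map[OF assms]
    by (auto simp: fun_eq_iff compose_def support_def)
qed

section \<open>Orbits of maps, supports and stabilizers\<close>

context group_action
begin

lemma action_in_funcset: "g \<in> carrier G \<Longrightarrow> \<phi> g \<in> E \<rightarrow> E"
  using surj_prop by blast

lemma action_inv:
  assumes "g \<in> carrier G"
  shows "inv g \<in> carrier G" "a \<in> E \<Longrightarrow> \<phi> (inv g) (\<phi> g a) = a" "a \<in> E \<Longrightarrow> \<phi> g (\<phi> (inv g) a) = a"
proof -
  interpret group G
    using group_hom group_hom.axioms(1) by auto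
  show *: "inv g \<in> carrier G" using assms by simp
  show "a \<in> E \<Longrightarrow> \<phi> (inv g) (\<phi> g a) = a"
    using assms orbit_sym_aux by blast
  show "a \<in> E \<Longrightarrow> \<phi> g (\<phi> (inv g) a) = a"
    using orbit_sym_aux[OF *] assms by auto
qed

lemma in_right_orbit_self:
  assumes "f \<in> extensional E"
  shows "f \<in> right_orbit G E \<phi> f"
proof -
  interpret group G
    using group_hom group_hom.axioms(1) by auto
  have "compose E f (\<phi> \<one>) = f"
    unfolding id_eq_one[symmetric] using assms by (auto simp: compose_def fun_eq_iff extensional_def)
  then show ?thesis unfolding right_orbit_def by force
qed

text \<open>Acting by \<open>g\<close> and then by \<open>h\<close> is precomposition with the
  action of \<open>g \<otimes> h\<close>, as for any right action.\<close>

lemma right_orbit_subset: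
  assumes "f' \<in> right_orbit G E \<phi> f"
  shows "right_orbit G E \<phi> f' \<subseteq> right_orbit G E \<phi> f"
proof
  interpret group G
    using group_hom group_hom.axioms(1) by auto
  fix k assume "k \<in> right_orbit G E \<phi> f'"
  then obtain g h where gh: "g \<in> carrier G" "h \<in> carrier G" "k = compose E (compose E f (\<phi> g)) (\<phi> h)"
    using assms unfolding right_orbit_def by blast
  have "k = compose E f (\<phi> (g \<otimes> h))"
    using gh action_in_funcset[OF gh(2)] by (auto simp: compose_def fun_eq_iff composition_rule Pi_iff)
  then show "k \<in> right_orbit G E \<phi> f"
    using gh unfolding right_orbit_def by blast
qed

text \<open>Acting by the inverse of \<open>g\<close> leads back from \<open>f'\<close> to
  \<open>f\<close>, so the inclusion of orbits holds both ways. Extensionality of \<open>f\<close>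
  is what lets the truncated composites return \<open>f\<close> itself.\<close>

lemma right_orbit_eq:
  assumes "f \<in> extensional E" "f' \<in> right_orbit G E \<phi> f"
  shows "right_orbit G E \<phi> f' = right_orbit G E \<phi> f"
proof
  obtain g where g: "g \<in> carrier G" "f' = compose E f (\<phi> g)"
    using assms(2) by (auto simp: right_orbit_def)
  have "f = compose E f' (\<phi> (inv g))"
    using g action_inv[OF g(1)] action_in_funcset assms(1)
    by (auto simp: compose_def fun_eq_iff Pi_iff extensional_def)
  then have "f \<in> right_orbit G E \<phi> f'"
    using action_inv(1)[OF g(1)] by (auto simp: right_orbit_def)
  then show "right_orbit G E \<phi> f \<subseteq> right_orbit G E \<phi> f'"
    by (rule right_orbit_subset)
qed (rule right_orbit_subset[OF assms(2)])

lemma right_orbit_PiE: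
  assumes "f \<in> E \<rightarrow>\<^sub>E X" "f' \<in> right_orbit G E \<phi> f"
  shows "f' \<in> E \<rightarrow>\<^sub>E X"
proof -
  obtain g where g: "g \<in> carrier G" "f' = compose E f (\<phi> g)"
    using assms(2) by (auto simp: right_orbit_def)
  then show ?thesis
    using assms(1) action_in_funcset[OF g(1)] by (auto simp: compose_def Pi_iff)
qed

text \<open>A point lies in the new support exactly when \<open>\<phi> g\<close> moves it into the
  old one; the inverse appears because the support is pulled back along
  \<open>\<phi> g\<close>.\<close>

lemma support_action:
  assumes "g \<in> carrier G"
  shows "support pt E (compose E f (\<phi> g)) = \<phi> (inv g) ` support pt E f"
proof -
  have "a \<in> \<phi> (inv g) ` support pt E f" if "a \<in> E" "f (\<phi> g a) \<noteq> pt" for a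
    using that action_inv(2)[OF assms that(1)] action_in_funcset[OF assms]
    by (intro image_eqI[of _ _ "\<phi> g a"]) (auto simp: support_def)
  then show ?thesis
    using action_inv[OF assms] action_in_funcset
    by (auto simp: support_def compose_def Pi_iff)
qed

lemma orbit_representatives_ex:
  assumes "orbit_representatives G (proper_subsets E) (subset_action E \<phi>) S" "B \<subset> E"
  obtains g where "g \<in> carrier G" "\<phi> g ` B \<in> S"
proof -
  have "orbit G (subset_action E \<phi>) B \<in> orbits G (proper_subsets E) (subset_action E \<phi>)"
    using assms(2) by (auto simp: orbits_def proper_subsets_def)
  then obtain B' where "B' \<in> S" "B' \<in> orbit G (subset_action E \<phi>) B"
    using assms(1) unfolding orbit_representatives_def by blast
  then show ?thesis
    using that assms(2) by (auto simp: orbit_def subset_action_def proper_subsets_def)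
qed

text \<open>\<open>B\<close> and its translate lie in the same orbit, which meets \<open>S\<close>
  only once.\<close>

lemma orbit_representatives_unique:
  assumes S: "orbit_representatives G (proper_subsets E) (subset_action E \<phi>) S"
    and B: "B \<in> S" and g: "g \<in> carrier G" "\<phi> g ` B \<in> S"
  shows "\<phi> g ` B = B"
proof -
  interpret group G
    using group_hom group_hom.axioms(1) by auto
  have "B \<subset> E"
    using S B by (auto simp: orbit_representatives_def proper_subsets_def)
  then have act: "subset_action E \<phi> h B = \<phi> h ` B" for h
    by (simp add: subset_action_def proper_subsets_def)
  have "\<phi> \<one> ` B = B"
    unfolding id_eq_one[symmetric] using \<open>B \<subset> E\<close> by auto
  then have "B \<in> orbit G (subset_action E \<phi>) B" "\<phi> g ` B \<in> orbit G (subset_action E \<phi>) B"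
    using act g by (force simp: orbit_def)+
  moreover have "orbit G (subset_action E \<phi>) B \<in> orbits G (proper_subsets E) (subset_action E \<phi>)"
    using \<open>B \<subset> E\<close> by (auto simp: orbits_def proper_subsets_def)
  ultimately show ?thesis
    using S B g(2) unfolding orbit_representatives_def by blast
qed

lemma set_stabilizer_iff:
  "B \<subset> E \<Longrightarrow> g \<in> set_stabilizer G E \<phi> B \<longleftrightarrow> g \<in> carrier G \<and> \<phi> g ` B = B"
  by (auto simp: stabilizer_def subset_action_def proper_subsets_def)

text \<open>Removes the inverse that \<open>support_action\<close> introduces, so that keeping a
  support can be compared with membership in the stabilizer.\<close>

lemma image_inv_eq_iff:
  assumes "g \<in> carrier G" "B \<subseteq> E"
  shows "\<phi> (inv g) ` B = B \<longleftrightarrow> \<phi> g ` B = B"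
proof -
  have "\<phi> (inv g) ` \<phi> g ` B = B" "\<phi> g ` \<phi> (inv g) ` B = B"
    using action_inv[OF assms(1)] assms(2) by (force simp: image_iff)+
  then show ?thesis by metis
qed

text \<open>A stabilizing \<open>g\<close> keeps the support and permutes it, so precomposition can
  be computed inside the support.\<close>

lemma support_part_action:
  assumes "g \<in> carrier G" "support pt E f \<subset> E" "\<phi> g ` support pt E f = support pt E f"
  shows "support_part inl pt E (compose E f (\<phi> g)) =
    compose (support pt E f) (support_part inl pt E f) (restrict (\<phi> g) (support pt E f))"
proof -
  let ?B = "support pt E f"
  have supp: "support pt E (compose E f (\<phi> g)) = ?B"
    using image_inv_eq_iff[OF assms(1), of ?B] assms(2,3) by (simp add: support_action[OF assms(1)])
  have "\<phi> g a \<in> ?B" if "a \<in> ?B" for a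
    using that assms(3) by blast
  then show ?thesis
    unfolding support_part_def supp using assms(2) by (auto simp: fun_eq_iff compose_def)
qed

text \<open>The passage from \<open>G\<close> to Stab(B): with B the support of \<open>f\<close>,
  acting by \<open>g\<close> keeps B exactly when \<open>g\<close> stabilizes B. The maps of the
  orbit with support B are therefore the translates of \<open>f\<close> by Stab(B), and their
  partial maps form one Stab(B)-orbit.\<close>

lemma support_part_right_orbit:
  assumes "support pt E f \<subset> E"
  shows "support_part inl pt E ` {f' \<in> right_orbit G E \<phi> f. support pt E f' = support pt E f} =
    right_orbit (G\<lparr>carrier := set_stabilizer G E \<phi> (support pt E f)\<rparr>) (support pt E f)
      (\<lambda>g. restrict (\<phi> g) (support pt E f)) (support_part inl pt E f)"
    (is "?P ` ?U = ?R")
proof -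
  let ?B = "support pt E f"
  have stab: "support pt E (compose E f (\<phi> g)) = ?B \<longleftrightarrow> \<phi> g ` ?B = ?B" if "g \<in> carrier G" for g
    using image_inv_eq_iff[OF that, of ?B] assms by (simp add: support_action[OF that])
  have "?U = (\<lambda>g. compose E f (\<phi> g)) ` {g \<in> carrier G. \<phi> g ` ?B = ?B}"
    using stab by (auto simp: right_orbit_def)
  then have "?P ` ?U = (\<lambda>g. compose ?B (?P f) (restrict (\<phi> g) ?B)) ` {g \<in> carrier G. \<phi> g ` ?B = ?B}"
    using support_part_action[OF _ assms] by (simp add: image_image)
  also have "\<dots> = ?R"
    using set_stabilizer_iff[OF assms] by (auto simp: right_orbit_def)
  finally show ?thesis .
qed

section \<open>The orbits that make up the difference functor\<close>

text \<open>The image consists of the orbits of maps factoring through \<open>inl\<close>, and a map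
  into X + 1 factors so exactly when it avoids \<open>pt\<close>.\<close>

lemma right_orbit_in_image_iff:
  assumes inl: "inj inl" "pt \<notin> range inl" and f: "f \<in> E \<rightarrow>\<^sub>E plus1 inl pt X"
  shows "right_orbit G E \<phi> f \<in> Ar (power_quotient G E \<phi>) X (plus1 inl pt X) (\<lambda>x\<in>X. inl x) `
      Ob (power_quotient G E \<phi>) X \<longleftrightarrow> support pt E f = E" (is "_ \<in> ?I \<longleftrightarrow> _")
proof -
  have I: "?I = (\<lambda>h. right_orbit G E \<phi> (compose E (\<lambda>x\<in>X. inl x) h)) ` (E \<rightarrow>\<^sub>E X)"
    unfolding Ob_power_quotient image_image
    using Ar_power_quotient_orbit[of G \<phi> E, OF action_in_funcset] by (rule image_cong[OF refl])
  show ?thesis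
  proof
    assume "right_orbit G E \<phi> f \<in> ?I"
    then obtain h where h: "h \<in> E \<rightarrow>\<^sub>E X"
      and "right_orbit G E \<phi> f = right_orbit G E \<phi> (compose E (\<lambda>x\<in>X. inl x) h)"
      unfolding I by blast
    \<comment> \<open>Equality of orbits only makes \<open>f\<close> a translate of the factored
      map, but translation keeps all values inside the image of \<open>X\<close> under
      \<open>inl\<close>.\<close>
    then have "f \<in> right_orbit G E \<phi> (compose E (\<lambda>x\<in>X. inl x) h)"
      using in_right_orbit_self[of f] f by (auto simp: PiE_iff)
    then have "f \<in> E \<rightarrow>\<^sub>E inl ` X"
      by (rule right_orbit_PiE[rotated]) (rule PiE_compose[OF h], simp)
    then show "support pt E f = E"
      using inl(2) by (auto simp: support_def PiE_iff)
  next
    assume supp: "support pt E f = E"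
    let ?h = "support_part inl pt E f"
    have h: "?h \<in> E \<rightarrow>\<^sub>E X"
      using support_part_in_PiE[OF inl(1) f] supp by simp
    have "compose E (\<lambda>x\<in>X. inl x) ?h a = f a" for a
    proof (cases "a \<in> E")
      case True
      then show ?thesis
        using inl_inv_on_support[OF f, of a] PiE_mem[OF h True] supp
        by (simp add: compose_def support_part_def)
    qed (use f in \<open>auto simp: compose_def\<close>)
    then have "compose E (\<lambda>x\<in>X. inl x) ?h = f" ..
    then show "right_orbit G E \<phi> f \<in> ?I"
      unfolding I using h by (metis imageI)
  qed
qed

text \<open>The required instance of tautness holds because \<open>k + 1\<close> preserves supports:
  if the composite has full support, then so does \<open>f\<close>.\<close>

lemma is_functor_difference_power_quotient:
  assumes inl: "inj inl" "pt \<notin> range inl"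
  shows "is_functor (difference_functor inl pt (power_quotient G E \<phi>))"
proof (rule is_functor_difference[OF inl])
  show "is_functor (power_quotient G E \<phi>)"
    using action_in_funcset by (rule is_functor_power_quotient)
next
  fix X Y k u
  assume k: "k \<in> X \<rightarrow>\<^sub>E Y" and u: "u \<in> Ob (power_quotient G E \<phi>) (plus1 inl pt X)"
    and im: "Ar (power_quotient G E \<phi>) (plus1 inl pt X) (plus1 inl pt Y) (plus1_map inl pt X k) u
      \<in> Ar (power_quotient G E \<phi>) Y (plus1 inl pt Y) (\<lambda>y\<in>Y. inl y) ` Ob (power_quotient G E \<phi>) Y"
  obtain f where f: "f \<in> E \<rightarrow>\<^sub>E plus1 inl pt X" "u = right_orbit G E \<phi> f"
    using u by (auto simp: Ob_power_quotient)
  have "compose E (plus1_map inl pt X k) f \<in> E \<rightarrow>\<^sub>E plus1 inl pt Y"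
    using f(1) plus1_map_in_PiE[OF inl k] by (rule PiE_compose)
  then have "support pt E (compose E (plus1_map inl pt X k) f) = E"
    using im f by (simp add: right_orbit_in_image_iff[OF inl] Ar_power_quotient_orbit action_in_funcset)
  then show "u \<in> Ar (power_quotient G E \<phi>) X (plus1 inl pt X) (\<lambda>x\<in>X. inl x) `
      Ob (power_quotient G E \<phi>) X"
    using right_orbit_in_image_iff[OF inl f(1)] support_plus1_map[OF inl f(1)] f(2) by simp
qed

text \<open>Any representative has a proper support, some \<open>g\<close> moves that support into
  \<open>S\<close>, and the representative can be translated accordingly.\<close>

lemma difference_power_quotient_rep:
  assumes inl: "inj inl" "pt \<notin> range inl"
    and S: "orbit_representatives G (proper_subsets E) (subset_action E \<phi>) S"
    and u: "u \<in> Ob (difference_functor inl pt (power_quotient G E \<phi>)) X"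
  obtains f where "f \<in> E \<rightarrow>\<^sub>E plus1 inl pt X" "u = right_orbit G E \<phi> f" "support pt E f \<in> S"
proof -
  obtain f where f: "f \<in> E \<rightarrow>\<^sub>E plus1 inl pt X" "u = right_orbit G E \<phi> f"
    using u by (auto simp: Ob_difference_functor Ob_power_quotient)
  have "support pt E f \<noteq> E"
    using u right_orbit_in_image_iff[OF inl f(1)] f(2) by (simp add: Ob_difference_functor)
  then have "support pt E f \<subset> E"
    by (auto simp: support_def)
  then obtain g where g: "g \<in> carrier G" "\<phi> g ` support pt E f \<in> S"
    using orbit_representatives_ex[OF S] by blast
  interpret group G
    using group_hom group_hom.axioms(1) by auto
  \<comment> \<open>Acting by the inverse of \<open>g\<close> translates the support by
    \<open>g\<close> itself, since \<open>support_action\<close> inverts once more.\<close>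
  let ?f = "compose E f (\<phi> (inv g))"
  have "?f \<in> right_orbit G E \<phi> f"
    using g by (auto simp: right_orbit_def)
  then have "?f \<in> E \<rightarrow>\<^sub>E plus1 inl pt X" "right_orbit G E \<phi> ?f = right_orbit G E \<phi> f"
    using right_orbit_PiE[OF f(1)] right_orbit_eq[of f ?f] f(1) by (simp_all add: PiE_iff)
  moreover have "support pt E ?f \<in> S"
    using g by (simp add: support_action)
  ultimately show ?thesis
    using that f(2) by metis
qed

end

section \<open>The natural isomorphism\<close>

text \<open>The second component is the image of all maps in \<open>u\<close> with support
  \<open>B\<close>, not of a chosen one, so no independence of a choice has to be proved. One
  formula serves all \<open>X\<close>.\<close>

definition orbit_splitting ::
    "('u \<Rightarrow> 'u) \<Rightarrow> 'u \<Rightarrow> 'a set \<Rightarrow> 'a set set \<Rightarrow> ('a \<Rightarrow> 'u) set \<Rightarrow> 'a set \<times> ('a \<Rightarrow> 'u) set" where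
  "orbit_splitting inl pt A S u =
     (let B = (THE B. B \<in> S \<and> B \<in> support pt A ` u)
      in (B, support_part inl pt A ` {f \<in> u. support pt A f = B}))"

context group_action
begin

text \<open>All supports occurring in the orbit are translates of the support of \<open>f\<close>,
  so by uniqueness of representatives no other one lies in \<open>S\<close>, and \<open>THE\<close>
  selects it.\<close>

lemma orbit_splitting_orbit:
  assumes S: "orbit_representatives G (proper_subsets E) (subset_action E \<phi>) S"
    and f: "f \<in> extensional E" "support pt E f \<in> S"
  shows "orbit_splitting inl pt E S (right_orbit G E \<phi> f) =
    (support pt E f, support_part inl pt E `
      {f' \<in> right_orbit G E \<phi> f. support pt E f' = support pt E f})"
proof -
  let ?u = "right_orbit G E \<phi> f"
  have "support pt E f' = support pt E f" if f': "f' \<in> ?u" "support pt E f' \<in> S" for f'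
  proof -
    obtain g where "g \<in> carrier G" "support pt E f' = \<phi> (inv g) ` support pt E f"
      using f'(1) by (auto simp: right_orbit_def support_action)
    then show ?thesis
      using orbit_representatives_unique[OF S f(2)] action_inv(1) f'(2) by simp
  qed
  then have "(THE B. B \<in> S \<and> B \<in> support pt E ` ?u) = support pt E f"
    using f(2) in_right_orbit_self[OF f(1)] by (intro the_equality) blast+
  then show ?thesis by (simp add: orbit_splitting_def Let_def)
qed

lemma orbit_splitting_natural_iso:
  assumes inl: "inj inl" "pt \<notin> range inl"
    and S: "orbit_representatives G (proper_subsets E) (subset_action E \<phi>) S"
  shows "is_natural_iso
    (difference_functor inl pt (power_quotient G E \<phi>))
    (sum_functor S (\<lambda>B. power_quotient
      (G\<lparr>carrier := set_stabilizer G E \<phi> B\<rparr>) B (\<lambda>g. restrict (\<phi> g) B)))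
    (\<lambda>X. orbit_splitting inl pt E S)"
    (is "is_natural_iso ?D (sum_functor S ?P) _")
proof -
  let ?\<eta> = "orbit_splitting inl pt E S"
  let ?orb = "\<lambda>B. right_orbit (G\<lparr>carrier := set_stabilizer G E \<phi> B\<rparr>) B (\<lambda>g. restrict (\<phi> g) B)"
  note rep = difference_power_quotient_rep[OF inl S]
  have S_sub: "B \<subset> E" if "B \<in> S" for B
    using S that by (auto simp: orbit_representatives_def proper_subsets_def)
  have stab_maps: "restrict (\<phi> g) B \<in> B \<rightarrow> B"
    if "B \<in> S" "g \<in> carrier (G\<lparr>carrier := set_stabilizer G E \<phi> B\<rparr>)" for B g
    using that set_stabilizer_iff[OF S_sub] by auto
  have Ob_sum: "Ob (sum_functor S ?P) X = (SIGMA B:S. ?orb B ` (B \<rightarrow>\<^sub>E X))" for X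
    by (simp add: sum_functor_def Ob_power_quotient)
  \<comment> \<open>Two descriptions of the same value: the set of partial maps serves injectivity,
    the stabilizer orbit in \<open>\<eta>_orbit\<close> serves surjectivity and naturality.\<close>
  have \<eta>_set: "?\<eta> (right_orbit G E \<phi> f) = (support pt E f, support_part inl pt E `
      {f' \<in> right_orbit G E \<phi> f. support pt E f' = support pt E f})"
    if "f \<in> E \<rightarrow>\<^sub>E plus1 inl pt X" "support pt E f \<in> S" for f X
    using orbit_splitting_orbit[OF S _ that(2)] that(1) by (simp add: PiE_iff)
  then have \<eta>_orbit: "?\<eta> (right_orbit G E \<phi> f) =
      (support pt E f, ?orb (support pt E f) (support_part inl pt E f))"
    if "f \<in> E \<rightarrow>\<^sub>E plus1 inl pt X" "support pt E f \<in> S" for f X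
    using that support_part_right_orbit[OF S_sub[OF that(2)], of inl] by simp
  have inj: "inj_on ?\<eta> (Ob ?D X)" for X
  proof (rule inj_onI)
    fix u v assume u: "u \<in> Ob ?D X" and v: "v \<in> Ob ?D X" and eq: "?\<eta> u = ?\<eta> v"
    obtain f where f: "f \<in> E \<rightarrow>\<^sub>E plus1 inl pt X" "u = right_orbit G E \<phi> f" "support pt E f \<in> S"
      using rep[OF u] .
    obtain k where k: "k \<in> E \<rightarrow>\<^sub>E plus1 inl pt X" "v = right_orbit G E \<phi> k" "support pt E k \<in> S"
      using rep[OF v] .
    have ext: "f \<in> extensional E" "k \<in> extensional E"
      using f(1) k(1) by (auto simp: PiE_iff)
    have "support pt E k = support pt E f"
      and parts: "support_part inl pt E ` {f' \<in> u. support pt E f' = support pt E f} =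
        support_part inl pt E ` {f' \<in> v. support pt E f' = support pt E k}"
      using eq \<eta>_set[OF f(1,3)] \<eta>_set[OF k(1,3)] f(2) k(2) by auto
    moreover have "k \<in> v"
      using in_right_orbit_self[OF ext(2)] k(2) by simp
    \<comment> \<open>The partial map of \<open>k\<close> belongs to the second component for
      \<open>v\<close>, hence to that for \<open>u\<close>. The resulting \<open>f'\<close> will
      equal \<open>k\<close>, so the two orbits share an element.\<close>
    ultimately obtain f' where f': "f' \<in> u" "support pt E f' = support pt E k"
        "support_part inl pt E f' = support_part inl pt E k"
      by (smt (verit, best) image_iff mem_Collect_eq)
    have "f' \<in> E \<rightarrow>\<^sub>E plus1 inl pt X"
      using f'(1) f(1,2) right_orbit_PiE by blast
    then have "f' = k"
      using support_part_inject[OF _ k(1)] f' by blast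
    then show "u = v"
      using right_orbit_eq[OF ext(1)] f'(1) f(2) k(2) by blast
  qed
  have "?\<eta> ` Ob ?D X = Ob (sum_functor S ?P) X" for X
  proof (rule Set.set_eqI, rule iffI)
    fix w assume "w \<in> ?\<eta> ` Ob ?D X"
    then obtain u where "u \<in> Ob ?D X" "w = ?\<eta> u" by blast
    then obtain f where f: "f \<in> E \<rightarrow>\<^sub>E plus1 inl pt X" "support pt E f \<in> S"
        "w = ?\<eta> (right_orbit G E \<phi> f)"
      using rep by metis
    then show "w \<in> Ob (sum_functor S ?P) X"
      unfolding Ob_sum f(3) \<eta>_orbit[OF f(1,2)] using support_part_in_PiE[OF inl(1) f(1)] by auto
  next
    fix w assume "w \<in> Ob (sum_functor S ?P) X"
    then obtain B h where w: "B \<in> S" "h \<in> B \<rightarrow>\<^sub>E X" "w = (B, ?orb B h)"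
      unfolding Ob_sum by blast
    obtain f where f: "f \<in> E \<rightarrow>\<^sub>E plus1 inl pt X" "support pt E f = B" "support_part inl pt E f = h"
      using support_part_extend[OF inl _ w(2), of E] S_sub[OF w(1)] by blast
    \<comment> \<open>Members of \<open>S\<close> are proper subsets, and this is what keeps the
      orbit of \<open>f\<close> out of the removed image.\<close>
    have "support pt E f \<noteq> E"
      using S_sub[OF w(1)] f(2) by blast
    then have "right_orbit G E \<phi> f \<in> Ob ?D X"
      using right_orbit_in_image_iff[OF inl f(1)] f(1)
      by (simp add: Ob_difference_functor Ob_power_quotient)
    moreover have "?\<eta> (right_orbit G E \<phi> f) = w"
      using \<eta>_orbit[OF f(1)] f w by simp
    ultimately show "w \<in> ?\<eta> ` Ob ?D X" by blast
  qed
  with inj have bij: "bij_betw ?\<eta> (Ob ?D X) (Ob (sum_functor S ?P) X)" for X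
    by (simp add: bij_betw_def)
  have natural: "?\<eta> (Ar ?D X Y k u) = Ar (sum_functor S ?P) X Y k (?\<eta> u)"
    if k: "k \<in> X \<rightarrow>\<^sub>E Y" and u: "u \<in> Ob ?D X" for X Y k u
  proof -
    obtain f where f: "f \<in> E \<rightarrow>\<^sub>E plus1 inl pt X" "u = right_orbit G E \<phi> f" "support pt E f \<in> S"
      using rep[OF u] .
    let ?B = "support pt E f"
    let ?h = "support_part inl pt E f"
    let ?f = "compose E (plus1_map inl pt X k) f"
    have f': "?f \<in> E \<rightarrow>\<^sub>E plus1 inl pt Y"
      using f(1) plus1_map_in_PiE[OF inl k] by (rule PiE_compose)
    have h: "?h \<in> ?B \<rightarrow>\<^sub>E X"
      using support_part_in_PiE[OF inl(1) f(1)] .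
    have "Ar ?D X Y k u = right_orbit G E \<phi> ?f"
      using u Ar_power_quotient_orbit[of G \<phi> E] action_in_funcset f
      by (simp add: Ar_difference_functor)
    then have "?\<eta> (Ar ?D X Y k u) = (?B, ?orb ?B (compose ?B k ?h))"
      using \<eta>_orbit[OF f'] f(3) support_plus1_map[OF inl f(1)] support_part_plus1_map[OF inl f(1)]
      by simp
    \<comment> \<open>The formula for arrows on orbits again, now for the stabilizer acting on
      \<open>?B\<close>.\<close>
    also have "\<dots> = (?B, Ar (?P ?B) X Y k (?orb ?B ?h))"
      by (subst Ar_power_quotient_orbit[OF stab_maps[OF f(3)] h]) simp_all
    also have "\<dots> = Ar (sum_functor S ?P) X Y k (?B, ?orb ?B ?h)"
      using f(3) h by (simp add: sum_functor_def Ob_power_quotient)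
    also have "(?B, ?orb ?B ?h) = ?\<eta> u"
      using \<eta>_orbit[OF f(1,3)] f(2) by simp
    finally show ?thesis .
  qed
  show ?thesis
    unfolding is_natural_iso_def by (intro conjI allI ballI bij natural)
qed

end

theorem proposition4p2p2:
  fixes G :: "('g, 'm) monoid_scheme"
    and A :: "'a set"
    and \<phi> :: "'g \<Rightarrow> 'a \<Rightarrow> 'a"
    and S :: "'a set set"
    and inl :: "'u \<Rightarrow> 'u"
    and pt :: 'u
  assumes "group_action G A \<phi>"
    and "orbit_representatives G (proper_subsets A) (subset_action A \<phi>) S"
    and "inj inl" and "pt \<notin> range inl"
  shows "isomorphic_functors
           (difference_functor inl pt (power_quotient G A \<phi>))
           (sum_functor S (\<lambda>B. power_quotient
              (G\<lparr>carrier := set_stabilizer G A \<phi> B\<rparr>) B (\<lambda>g. restrict (\<phi> g) B)))"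
proof -
  interpret group_action G A \<phi> by fact
  have "restrict (\<phi> g) B \<in> B \<rightarrow> B"
    if "B \<in> S" "g \<in> carrier (G\<lparr>carrier := set_stabilizer G A \<phi> B\<rparr>)" for B g
  proof -
    have "B \<subset> A"
      using assms(2) that(1) by (auto simp: orbit_representatives_def proper_subsets_def)
    then show ?thesis using that(2) set_stabilizer_iff by auto
  qed
  then have "is_functor (sum_functor S (\<lambda>B. power_quotient
      (G\<lparr>carrier := set_stabilizer G A \<phi> B\<rparr>) B (\<lambda>g. restrict (\<phi> g) B)))"
    by (intro is_functor_sum is_functor_power_quotient)
  then show ?thesis
    unfolding isomorphic_functors_def
    using is_functor_difference_power_quotient[OF assms(3,4)]
      orbit_splitting_natural_iso[OF assms(3,4,2)] by blast
qed

end
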